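(* Let $\mathbb F\in\{\mathbb R,\mathbb C\}$ and let $l\le m\le n$ be positive integers with $n\ge 2$. Let $\mathcal P=\{P_j\}_{j=1}^n$ be an optimally spread $(n,l)$-packing for $\mathbb F^m$, with corresponding subspaces $\mathbb W_j=\operatorname{im}(P_j)$, and let $$\mathcal K:=\{1\le k\le n:\ \mathbb W_k \text{ achieves the packing constant}\}.$$ Then $\operatorname{span}\{\mathbb W_k: k\in\mathcal K\}=\mathbb F^m$, meaning that $\{\mathbb W_k\}_{k\in\mathcal K}$ is an $(n',l)$-fusion frame for $\mathbb F^m$, where $n':=|\mathcal K|$. Consequently, $\mathcal P$ is an $(n,l)$-fusion frame for $\mathbb F^m$ and, in particular, a Grassmannian fusion frame.
   Context: An $(n,l)$-packing for $\mathbb F^m$ is a finite sequence $\{\mathbb W_j\}_{j=1}^n$ of $l$-dimensional subspaces of $\mathbb F^m$, identified with the sequence $\{P_j\}_{j=1}^n$ of orthogonal projections ($P_j=P_j^2=P_j^*$, $\operatorname{tr}(P_j)=l$) onto them. The coherence of a packing $\mathcal P=\{P_j\}_{j=1}^n$ is $\mu(\mathcal P):=\max_{j\ne j'}\operatorname{tr}(P_jP_{j'})$, and the packing constant is $\mu_{n,l,\mathbb F^m}:=\inf\mu(\mathcal P)$, the infimum over all $(n,l)$-packings $\mathcal P$ for $\mathbb F^m$. The packing $\mathcal P$ is optimally spread if $\mu(\mathcal P)=\mu_{n,l,\mathbb F^m}$. An element $P_k$ (or $\mathbb W_k$) of an optimally spread $(n,l)$-packing achieves the packing constant if there is $k'\in\{1,\dots,n\}$,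 $k'\ne k$, with $\operatorname{tr}(P_kP_{k'})=\mu_{n,l,\mathbb F^m}$. A packing $\{P_j\}_{j=1}^N$ of $N$ subspaces of dimension $l$ is an $(N,l)$-fusion frame for $\mathbb F^m$ if $\sum_{j=1}^N P_j$ is positive definite (equivalently, the subspaces span $\mathbb F^m$); no relation between $N$ and $m$ is imposed here. An $(n,l)$-fusion frame is Grassmannian if it is optimally spread. *)

theory Defs
  imports "HOL-Analysis.Analysis"
begin

text \<open>The scalar fields \<open>\<real>\<close> and \<open>\<complex>\<close> are treated uniformly by a type class. Its axioms force every
  element to be a root of the real polynomial \<open>x\<^sup>2 - 2 re(a) x + \<bar>a\<bar>\<^sup>2\<close>, so the class has no instances
  other than \<open>\<real>\<close> and \<open>\<complex>\<close> up to isomorphism; see \<open>real_or_complex_cases\<close>.\<close>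

class real_or_complex = real_normed_field +
  fixes cconj :: "'a \<Rightarrow> 'a"
    and re :: "'a \<Rightarrow> real"
  assumes cconj_add: "cconj (x + y) = cconj x + cconj y"
    and cconj_mult: "cconj (x * y) = cconj x * cconj y"
    and cconj_cconj: "cconj (cconj x) = x"
    and mult_cconj: "x * cconj x = ((norm x)\<^sup>2) *\<^sub>R 1"
    and add_cconj: "x + cconj x = (2 * re x) *\<^sub>R 1"

instantiation real :: real_or_complex
begin
definition cconj_real :: "real \<Rightarrow> real" where "cconj_real x = x"
definition re_real :: "real \<Rightarrow> real" where "re_real x = x"
instance
  by standard (simp_all add: cconj_real_def re_real_def power2_eq_square)
end

instantiation complex :: real_or_complex
begin
definition cconj_complex :: "complex \<Rightarrow> complex" where "cconj_complex = cnj"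
definition re_complex :: "complex \<Rightarrow> real" where "re_complex = Re"
instance
proof
  fix x y :: complex
  show "x * cconj x = ((norm x)\<^sup>2) *\<^sub>R 1"
    unfolding cconj_complex_def scaleR_conv_of_real complex_norm_square by simp
  show "x + cconj x = (2 * re x) *\<^sub>R 1"
    unfolding cconj_complex_def re_complex_def scaleR_conv_of_real complex_add_cnj by simp
qed (simp_all add: cconj_complex_def)
end

lemma real_or_complex_cases:
  "(UNIV :: 'a::real_or_complex set) = range of_real \<or>
   (\<exists>i :: 'a. i * i = -1 \<and> (\<forall>x. \<exists>a b. x = of_real a + of_real b * i))"
proof (cases "(UNIV :: 'a set) = range of_real")
  case False
  then obtain w :: 'a where w: "w \<notin> range of_real" by auto
  have quad: "(x - of_real (re x))\<^sup>2 = of_real ((re x)\<^sup>2 - (norm x)\<^sup>2)" for x :: 'a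
  proof -
    have "cconj x = of_real (2 * re x) - x"
      using add_cconj[of x] by (simp add: scaleR_conv_of_real eq_diff_eq add.commute)
    then have "x * (of_real (2 * re x) - x) = of_real ((norm x)\<^sup>2)"
      using mult_cconj[of x] by (simp add: scaleR_conv_of_real)
    moreover have "(x - of_real (re x))\<^sup>2 = of_real ((re x)\<^sup>2) - x * (of_real (2 * re x) - x)"
      by (simp add: power2_eq_square algebra_simps)
    ultimately show ?thesis by simp
  qed
  have sq_real: "x \<in> range of_real" if "x\<^sup>2 = of_real (c\<^sup>2)" for x :: 'a and c :: real
  proof -
    have "x = of_real c \<or> x = - of_real c"
      using that by (simp add: power2_eq_iff)
    then show ?thesis by (metis of_real_minus rangeI)
  qed
  have neg: "(re x)\<^sup>2 - (norm x)\<^sup>2 < 0" if "x \<notin> range of_real" for x :: 'a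
  proof (rule ccontr)
    assume "\<not> ?thesis"
    then have "(x - of_real (re x))\<^sup>2 = of_real ((sqrt ((re x)\<^sup>2 - (norm x)\<^sup>2))\<^sup>2)"
      using quad[of x] by simp
    then obtain a where "x - of_real (re x) = of_real a"
      using sq_real by blast
    then have "x = of_real (a + re x)" by (simp add: algebra_simps)
    with that show False by blast
  qed
  define r where "r x = sqrt ((norm x)\<^sup>2 - (re x)\<^sup>2)" for x :: 'a
  have r: "r x \<noteq> 0" "(x - of_real (re x))\<^sup>2 = - (of_real (r x))\<^sup>2" if "x \<notin> range of_real" for x :: 'a
    using neg[OF that] quad[of x]
    by (auto simp: r_def simp flip: of_real_power of_real_minus)
  define i where "i = (w - of_real (re w)) / of_real (r w)"
  have ii: "i * i = -1"
    using r[OF w] by (simp add: i_def power2_eq_square)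
  have "\<exists>a b. x = of_real a + of_real b * i" for x :: 'a
  proof (cases "x \<in> range of_real")
    case True
    then obtain a where "x = of_real a + of_real 0 * i" by auto
    then show ?thesis by blast
  next
    case False
    have "(x - of_real (re x))\<^sup>2 = (of_real (r x) * i)\<^sup>2"
      using r(2)[OF False] ii by (simp add: power_mult_distrib power2_eq_square[of i])
    then have "x - of_real (re x) = of_real (r x) * i \<or> x - of_real (re x) = of_real (- r x) * i"
      by (simp add: power2_eq_iff)
    then show ?thesis by (metis add_diff_cancel_left' diff_add_cancel add.commute)
  qed
  with ii show ?thesis by blast
qed simp

definition adjoint_matrix :: "'a::real_or_complex^'n^'m \<Rightarrow> 'a^'m^'n" where
  "adjoint_matrix A = (\<chi> i j. cconj (A $ j $ i))"

definition orthogonal_projection :: "'a::real_or_complex^'m^'m \<Rightarrow> bool" where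
  "orthogonal_projection P \<longleftrightarrow> P = P ** P \<and> P = adjoint_matrix P"

definition positive_definite :: "'a::real_or_complex^'m^'m \<Rightarrow> bool" where
  "positive_definite A \<longleftrightarrow>
     adjoint_matrix A = A \<and> (\<forall>x. x \<noteq> 0 \<longrightarrow> re (\<Sum>i\<in>UNIV. cconj (x $ i) * (A *v x) $ i) > 0)"

text \<open>Packings are given by their projections; the \<open>j\<close>-th subspace is \<open>range ((*v) (P j))\<close>.
  The index set is arbitrary, so that subfamilies can be spoken of; an \<open>(n,l)\<close>-packing is the case
  \<open>I = {1..n}\<close>, and the values of \<open>P\<close> outside \<open>I\<close> are irrelevant.\<close>

definition packing :: "'i set \<Rightarrow> nat \<Rightarrow> ('i \<Rightarrow> 'a::real_or_complex^'m^'m) \<Rightarrow> bool" where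
  "packing I l P \<longleftrightarrow> finite I \<and> (\<forall>j\<in>I. orthogonal_projection (P j) \<and> trace (P j) = of_nat l)"

text \<open>The trace of a product of two orthogonal projections is a real number; \<open>re\<close> only changes
  its type.\<close>

definition coherence :: "nat \<Rightarrow> (nat \<Rightarrow> 'a::real_or_complex^'m^'m) \<Rightarrow> real" where
  "coherence n P = Max {re (trace (P j ** P j')) | j j'. j \<in> {1..n} \<and> j' \<in> {1..n} \<and> j \<noteq> j'}"

definition packing_constant :: "nat \<Rightarrow> nat \<Rightarrow> ('a::real_or_complex^'m) itself \<Rightarrow> real" where
  "packing_constant n l _ =
     Inf {coherence n P | P :: nat \<Rightarrow> 'a^'m^'m. packing {1..n} l P}"

definition optimally_spread :: "nat \<Rightarrow> nat \<Rightarrow> (nat \<Rightarrow> 'a::real_or_complex^'m^'m) \<Rightarrow> bool" where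
  "optimally_spread n l P \<longleftrightarrow>
     packing {1..n} l P \<and> coherence n P = packing_constant n l TYPE('a^'m)"

definition achieves_packing_constant ::
    "nat \<Rightarrow> nat \<Rightarrow> (nat \<Rightarrow> 'a::real_or_complex^'m^'m) \<Rightarrow> nat \<Rightarrow> bool" where
  "achieves_packing_constant n l P k \<longleftrightarrow>
     (\<exists>k'\<in>{1..n}. k' \<noteq> k \<and> re (trace (P k ** P k')) = packing_constant n l TYPE('a^'m))"

definition fusion_frame ::
    "'i set \<Rightarrow> nat \<Rightarrow> nat \<Rightarrow> ('i \<Rightarrow> 'a::real_or_complex^'m^'m) \<Rightarrow> bool" where
  "fusion_frame I N l P \<longleftrightarrow>
     packing I l P \<and> card I = N \<and> positive_definite (\<Sum>j\<in>I. P j)"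

definition grassmannian_fusion_frame ::
    "nat \<Rightarrow> nat \<Rightarrow> (nat \<Rightarrow> 'a::real_or_complex^'m^'m) \<Rightarrow> bool" where
  "grassmannian_fusion_frame n l P \<longleftrightarrow> fusion_frame {1..n} n l P \<and> optimally_spread n l P"

end

theory Submission
  imports Defs
begin

text \<open>Suppose a unit vector \<open>x\<close> is orthogonal to every subspace achieving the packing constant \<open>\<mu>\<close>.
  If \<open>\<mu> > 0\<close>, pick such a subspace \<open>W\<close> and a unit vector \<open>w \<in> W\<close> that is orthogonal to none of the
  subspaces at maximal correlation with \<open>W\<close>, and rotate \<open>w\<close> slightly towards \<open>x\<close>. This strictly
  lowers the correlation of \<open>W\<close> with each of these subspaces and, by continuity, keeps the others below
  \<open>\<mu>\<close>. The new packing is still optimally spread, \<open>x\<close> is still orthogonal to all its achieving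
  subspaces, but there is at least one fewer of them; by descent this is absurd.
  If \<open>\<mu> = 0\<close>, the subspaces are mutually orthogonal, and counting dimensions shows that they fill the
  whole space.\<close>

section \<open>Conjugation and real part on the scalar field\<close>

lemma cconj_0 [simp]: "cconj (0::'a::real_or_complex) = 0"
  using cconj_add[of "0::'a" 0] by simp

lemma cconj_of_real [simp]: "cconj (of_real r :: 'a::real_or_complex) = of_real r"
proof (cases "r = 0")
  case False
  then show ?thesis
    using mult_cconj[of "of_real r :: 'a"] by (simp add: scaleR_conv_of_real power2_eq_square)
qed simp

lemma cconj_1 [simp]: "cconj (1::'a::real_or_complex) = 1"
  using cconj_of_real[of 1, where 'a='a] by simp

lemma cconj_minus: "cconj (- x) = - cconj (x::'a::real_or_complex)"
  using cconj_add[of x "- x"] by (simp add: eq_neg_iff_add_eq_0 add.commute)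

lemma cconj_diff: "cconj (x - y) = cconj x - cconj (y::'a::real_or_complex)"
  using cconj_add[of x "- y"] by (simp add: cconj_minus)

lemma cconj_sum: "cconj (sum f A) = (\<Sum>x\<in>A. cconj (f x :: 'a::real_or_complex))"
  by (induction A rule: infinite_finite_induct) (simp_all add: cconj_add)

lemma cconj_times_self: "cconj x * x = of_real ((norm (x::'a::real_or_complex))\<^sup>2)"
  using mult_cconj[of x] by (simp add: scaleR_conv_of_real mult.commute)

text \<open>Reals are fixed by conjugation, so \<open>add_cconj\<close> reads
  \<open>2 * r = 2 * re r\<close> inside the field, and \<open>of_real\<close> is injective.\<close>

lemma re_of_real [simp]: "re (of_real r :: 'a::real_or_complex) = r"
proof -
  have "of_real (r + r) = (of_real (2 * re (of_real r :: 'a)) :: 'a)"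
    using add_cconj[of "of_real r :: 'a"] by (simp add: scaleR_conv_of_real)
  then show ?thesis unfolding of_real_eq_iff by simp
qed

lemma re_0 [simp]: "re (0::'a::real_or_complex) = 0"
  using re_of_real[of 0, where 'a='a] by simp

lemma re_add: "re (x + y) = re x + re (y::'a::real_or_complex)"
proof -
  have "(of_real (2 * re (x + y)) :: 'a) = of_real (2 * re x + 2 * re y)"
    using arg_cong2[OF add_cconj[of x] add_cconj[of y], of "(+)"] add_cconj[of "x + y"]
    by (simp add: scaleR_conv_of_real cconj_add add_ac)
  then show ?thesis unfolding of_real_eq_iff by simp
qed

lemma re_diff: "re (x - y) = re x - re (y::'a::real_or_complex)"
  using re_add[of "x - y" y] by simp

section \<open>The Hermitian form, conjugate-linear in its first argument, and adjoint
  matrices\<close>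

definition hinner :: "'a::real_or_complex^'m \<Rightarrow> 'a^'m \<Rightarrow> 'a" where
  "hinner x y = (\<Sum>i\<in>UNIV. cconj (x $ i) * y $ i)"

lemma hinner_add_right: "hinner x (y + z) = hinner x y + hinner x z"
  by (simp add: hinner_def algebra_simps sum.distrib)

lemma hinner_scaleR_right: "hinner x (r *\<^sub>R y) = r *\<^sub>R hinner x y"
  by (simp add: hinner_def scaleR_sum_right)

lemma hinner_0_right [simp]: "hinner x 0 = 0"
  by (simp add: hinner_def)

lemma hinner_self: "hinner x x = of_real ((norm x)\<^sup>2)"
  by (simp add: hinner_def norm_vec_def L2_set_def sum_nonneg cconj_times_self)

lemma cconj_hinner: "cconj (hinner x y) = hinner y x"
  by (simp add: hinner_def cconj_sum cconj_mult cconj_cconj mult.commute)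

lemma hinner_adjoint: "hinner x (A *v y) = hinner (adjoint_matrix A *v x) y"
proof -
  have "hinner x (A *v y) = (\<Sum>i\<in>UNIV. \<Sum>j\<in>UNIV. cconj (x $ i) * (A $ i $ j * y $ j))"
    by (simp add: hinner_def matrix_vector_mult_def sum_distrib_left)
  also have "\<dots> = (\<Sum>j\<in>UNIV. \<Sum>i\<in>UNIV. cconj (x $ i) * (A $ i $ j * y $ j))"
    by (rule sum.swap)
  also have "\<dots> = hinner (adjoint_matrix A *v x) y"
    by (simp add: hinner_def matrix_vector_mult_def adjoint_matrix_def cconj_sum cconj_mult
        cconj_cconj sum_distrib_left mult_ac)
  finally show ?thesis .
qed

lemma adjoint_matrix_mult:
  "adjoint_matrix (A ** B) = adjoint_matrix B ** adjoint_matrix A"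
  by (simp add: adjoint_matrix_def matrix_matrix_mult_def vec_eq_iff cconj_sum cconj_mult mult.commute)

lemma adjoint_matrix_add: "adjoint_matrix (A + B) = adjoint_matrix A + adjoint_matrix B"
  by (simp add: adjoint_matrix_def vec_eq_iff cconj_add)

lemma adjoint_matrix_diff: "adjoint_matrix (A - B) = adjoint_matrix A - adjoint_matrix B"
  by (simp add: adjoint_matrix_def vec_eq_iff cconj_diff)

lemma adjoint_matrix_0 [simp]: "adjoint_matrix 0 = 0"
  by (simp add: adjoint_matrix_def vec_eq_iff)

lemma adjoint_matrix_mat_1 [simp]: "adjoint_matrix (mat 1) = mat 1"
  by (simp add: adjoint_matrix_def vec_eq_iff mat_def)

lemma adjoint_matrix_sum: "adjoint_matrix (sum f A) = (\<Sum>x\<in>A. adjoint_matrix (f x))"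
  by (induction A rule: infinite_finite_induct) (simp_all add: adjoint_matrix_add)

text \<open>This is the squared Frobenius norm; the signs and the vanishing of traces of products of
  projections are read off from it.\<close>

lemma trace_adjoint_mult_self:
  fixes A :: "'a::real_or_complex^'m^'k"
  shows "trace (adjoint_matrix A ** A) = of_real (\<Sum>j\<in>UNIV. \<Sum>i\<in>UNIV. (norm (A $ i $ j))\<^sup>2)"
  by (simp add: trace_def matrix_matrix_mult_def adjoint_matrix_def cconj_times_self)

lemma trace_adjoint_mult_self_nonneg: "0 \<le> re (trace (adjoint_matrix A ** A))"
  unfolding trace_adjoint_mult_self re_of_real by (intro sum_nonneg) simp

lemma trace_adjoint_mult_self_le_0_iff: "re (trace (adjoint_matrix A ** A)) \<le> 0 \<longleftrightarrow> A = 0"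
proof
  assume "re (trace (adjoint_matrix A ** A)) \<le> 0"
  then have "(\<Sum>j\<in>UNIV. \<Sum>i\<in>UNIV. (norm (A $ i $ j))\<^sup>2) = 0"
    using trace_adjoint_mult_self_nonneg[of A] unfolding trace_adjoint_mult_self re_of_real by simp
  then have "\<forall>j i. A $ i $ j = 0"
    by (subst (asm) sum_nonneg_eq_0_iff) (auto simp: sum_nonneg sum_nonneg_eq_0_iff)
  then show "A = 0" by (simp add: vec_eq_iff)
qed (simp add: trace_def)

section \<open>Linearity rules for matrix products\<close>

lemma matrix_vector_mult_eq_0_iff:
  fixes A :: "'a::field^'m^'k"
  shows "(\<forall>x. A *v x = 0) \<longleftrightarrow> A = 0"
  by (metis matrix_eq matrix_vector_mult_0)

lemma sum_matrix_vector_mult: "sum f A *v x = (\<Sum>j\<in>A. f j *v (x::'a::real_or_complex^'m))"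
  by (induction A rule: infinite_finite_induct) (simp_all add: matrix_vector_mult_add_rdistrib)

lemma matrix_add_rdistrib: "(A + B) ** C = A ** C + B ** (C :: 'a::semiring_1^'m^'k)"
  by (simp add: matrix_matrix_mult_def vec_eq_iff algebra_simps sum.distrib)

lemma matrix_diff_rdistrib: "(A - B) ** C = A ** C - B ** (C :: 'a::ring_1^'m^'k)"
  by (simp add: matrix_matrix_mult_def vec_eq_iff algebra_simps sum_subtractf)

lemma matrix_diff_ldistrib: "A ** (B - C) = A ** B - A ** (C :: 'a::ring_1^'m^'k)"
  by (simp add: matrix_matrix_mult_def vec_eq_iff algebra_simps sum_subtractf)

lemma matrix_vector_mult_sum: "A *v sum f I = (\<Sum>j\<in>I. A *v (f j :: 'a::real_or_complex^'m))"
  by (induction I rule: infinite_finite_induct) (simp_all add: matrix_vector_right_distrib)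

lemma matrix_vector_scaleR: "A *v (r *\<^sub>R x) = r *\<^sub>R (A *v (x::'a::real_or_complex^'m))"
  by (simp add: matrix_vector_mult_def vec_eq_iff scaleR_sum_right)

section \<open>Orthogonal projections and traces of their products\<close>

context
  fixes P :: "'a::real_or_complex^'m^'m"
  assumes P: "orthogonal_projection P"
begin

lemma projection_mult_self: "P ** P = P"
  using P by (simp add: orthogonal_projection_def)

lemma projection_adjoint: "adjoint_matrix P = P"
  using P by (simp add: orthogonal_projection_def)

lemma projection_idem: "P *v (P *v x) = P *v x"
  by (simp add: matrix_vector_mul_assoc projection_mult_self)

lemma hinner_projection: "hinner x (P *v x) = of_real ((norm (P *v x))\<^sup>2)"
  by (metis hinner_adjoint hinner_self projection_adjoint projection_idem)

end

text \<open>Since \<open>P\<close> is idempotent and the trace is cyclic, \<open>P ** Q\<close> has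
  the trace of \<open>P ** Q ** P\<close>, which is the Gram matrix of
  \<open>Q ** P\<close>.\<close>

lemma trace_projection_mult:
  assumes P: "orthogonal_projection P" and Q: "orthogonal_projection Q"
  shows "trace (P ** Q) = trace (adjoint_matrix (Q ** P) ** (Q ** P))"
proof -
  have "adjoint_matrix (Q ** P) ** (Q ** P) = P ** Q ** P"
    by (metis P Q adjoint_matrix_mult matrix_mul_assoc projection_adjoint projection_mult_self)
  moreover have "trace (P ** Q ** P) = trace (P ** Q)"
    by (metis P matrix_mul_assoc projection_mult_self trace_mul_sym)
  ultimately show ?thesis by simp
qed

lemma trace_projection_mult_nonneg:
  "orthogonal_projection P \<Longrightarrow> orthogonal_projection Q \<Longrightarrow> 0 \<le> re (trace (P ** Q))"
  by (simp add: trace_projection_mult trace_adjoint_mult_self_nonneg)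

lemma trace_projection_mult_le_0:
  "orthogonal_projection P \<Longrightarrow> orthogonal_projection Q \<Longrightarrow> re (trace (P ** Q)) \<le> 0 \<longleftrightarrow> Q ** P = 0"
  by (simp add: trace_projection_mult trace_adjoint_mult_self_le_0_iff)

lemma projection_eq_0_if_trace_le_0:
  assumes "orthogonal_projection P" "re (trace P) \<le> 0"
  shows "P = 0"
  using trace_projection_mult_le_0[OF assms(1) assms(1)] assms by (simp add: projection_mult_self)

section \<open>Rank-one operators and the rotation of one direction of a subspace\<close>

definition outer :: "'a::real_or_complex^'m \<Rightarrow> 'a^'m^'m" where
  "outer v = (\<chi> i j. v $ i * cconj (v $ j))"

lemma outer_mult_vector: "outer v *v x = hinner v x *s v"
  by (simp add: outer_def matrix_vector_mult_def hinner_def vec_eq_iff sum_distrib_left mult_ac)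

lemma adjoint_outer: "adjoint_matrix (outer v) = outer v"
  by (simp add: outer_def adjoint_matrix_def vec_eq_iff cconj_mult cconj_cconj mult.commute)

lemma trace_outer_mult: "trace (outer v ** Q) = hinner v (Q *v v)"
  unfolding trace_mul_sym[of "outer v"]
  by (simp add: outer_def trace_def matrix_matrix_mult_def hinner_def matrix_vector_mult_def
      sum_distrib_left mult_ac)

lemma trace_outer: "trace (outer v) = of_real ((norm v)\<^sup>2)"
  using trace_outer_mult[of v "mat 1"] by (simp add: hinner_self)

text \<open>For unit vectors \<open>w\<close> in the range and \<open>x\<close> in the kernel of
  \<open>P\<close>, this projects onto the subspace in which the line of \<open>w\<close> is
  replaced by that of \<open>cos t *\<^sub>R w + sin t *\<^sub>R x\<close>, the orthogonal
  complement of \<open>w\<close> in the range being kept.\<close>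

definition rotate_projection ::
    "'a::real_or_complex^'m^'m \<Rightarrow> 'a^'m \<Rightarrow> 'a^'m \<Rightarrow> real \<Rightarrow> 'a^'m^'m" where
  "rotate_projection P w x t = P - outer w + outer (cos t *\<^sub>R w + sin t *\<^sub>R x)"

context
  fixes P :: "'a::real_or_complex^'m^'m" and w x :: "'a^'m"
  assumes P: "orthogonal_projection P"
    and w: "P *v w = w" "norm w = 1"
    and x: "P *v x = 0" "norm x = 1"
begin

text \<open>Range and kernel of a self-adjoint idempotent are orthogonal: move \<open>P\<close> from
  \<open>w\<close> to \<open>x\<close>.\<close>

lemma hinner_range_kernel: "hinner w x = 0" "hinner x w = 0"
proof -
  show "hinner w x = 0"
    using hinner_adjoint[of w P x] projection_adjoint[OF P] w x by simp
  then show "hinner x w = 0"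
    using cconj_hinner[of w x] by simp
qed

lemma hinner_rotated:
  "hinner (cos t *\<^sub>R w + sin t *\<^sub>R x) (cos t *\<^sub>R w + sin t *\<^sub>R x) = 1"
  "hinner w (cos t *\<^sub>R w + sin t *\<^sub>R x) = of_real (cos t)"
proof -
  let ?v = "cos t *\<^sub>R w + sin t *\<^sub>R x"
  show wv: "hinner w ?v = of_real (cos t)"
    by (simp add: hinner_add_right hinner_scaleR_right hinner_range_kernel hinner_self w
        scaleR_conv_of_real[of _ "1::'a"])
  have xv: "hinner x ?v = of_real (sin t)"
    by (simp add: hinner_add_right hinner_scaleR_right hinner_range_kernel hinner_self x
        scaleR_conv_of_real[of _ "1::'a"])
  have vw: "hinner ?v w = of_real (cos t)" and vx: "hinner ?v x = of_real (sin t)"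
    using arg_cong[OF wv, of cconj] arg_cong[OF xv, of cconj] by (simp_all add: cconj_hinner)
  have "hinner ?v ?v = cos t *\<^sub>R hinner ?v w + sin t *\<^sub>R hinner ?v x"
    by (simp only: hinner_add_right hinner_scaleR_right)
  also have "\<dots> = of_real ((cos t)\<^sup>2 + (sin t)\<^sup>2)"
    unfolding vw vx
    by (simp add: scaleR_conv_of_real power2_eq_square flip: of_real_mult of_real_add)
  finally show "hinner ?v ?v = 1" by (simp only: sin_cos_squared_add2 of_real_1)
qed

lemma orthogonal_projection_rotate: "orthogonal_projection (rotate_projection P w x t)"
proof -
  define v where "v = cos t *\<^sub>R w + sin t *\<^sub>R x"
  let ?R = "rotate_projection P w x t"
  have R: "?R *v y = P *v y - hinner w y *s w + hinner v y *s v" for y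
    by (simp add: rotate_projection_def v_def[symmetric] matrix_vector_mult_add_rdistrib
        matrix_vector_mult_diff_rdistrib outer_mult_vector)
  have "P *v v = of_real (cos t) *s w"
    by (simp add: v_def matrix_vector_right_distrib matrix_vector_scaleR w x vec_eq_iff
        scaleR_conv_of_real[of _ "w $ _"])
  \<comment> \<open>\<open>P *v v\<close> and \<open>hinner w v *s w\<close> are both
    \<open>cos t\<close> times \<open>w\<close> and cancel, which leaves \<open>v\<close> because
    \<open>hinner v v = 1\<close>.\<close>
  then have Rv: "?R *v v = v"
    using hinner_rotated[of t] by (simp add: R v_def[symmetric])
  have adj: "adjoint_matrix ?R = ?R"
    by (simp add: rotate_projection_def adjoint_matrix_add adjoint_matrix_diff adjoint_outer
        projection_adjoint[OF P])
  have Rw: "?R *v w = hinner v w *s v"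
    by (simp add: R w hinner_self)
  have RP: "?R *v (P *v y) = P *v y - hinner w y *s w + hinner v (P *v y) *s v" for y
    using hinner_adjoint[of w P y] by (simp add: R projection_idem[OF P] projection_adjoint[OF P] w)
  \<comment> \<open>Moving \<open>P\<close> to the left argument turns \<open>v\<close> into
    \<open>cos t\<close> times \<open>w\<close>; this real factor equals
    \<open>hinner v w\<close>.\<close>
  have vP: "hinner v (P *v y) = hinner v w * hinner w y" for y
  proof -
    have "hinner v (P *v y) = hinner (of_real (cos t) *s w) y"
      using hinner_adjoint[of v P y] \<open>P *v v = _\<close> by (simp add: projection_adjoint[OF P])
    also have "\<dots> = of_real (cos t) * hinner w y"
      by (simp add: hinner_def cconj_mult sum_distrib_left mult_ac)
    finally show ?thesis
      using hinner_rotated(2)[of t] cconj_hinner[of w v] by (simp add: v_def[symmetric])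
  qed
  have "?R *v (?R *v y) = ?R *v y" for y
  proof -
    have "?R *v (?R *v y) = ?R *v (P *v y) - hinner w y *s (?R *v w) + hinner v y *s (?R *v v)"
      unfolding R[of y]
      by (simp add: matrix_vector_right_distrib matrix_vector_mult_diff_distrib vector_scalar_commute)
    also have "\<dots> = ?R *v y"
      unfolding RP Rw Rv vP R[of y] by (simp add: vec_eq_iff algebra_simps)
    finally show ?thesis .
  qed
  then have "?R ** ?R = ?R"
    by (simp add: matrix_eq matrix_vector_mul_assoc[symmetric])
  with adj show ?thesis by (simp add: orthogonal_projection_def)
qed

lemma trace_rotate_projection: "trace (rotate_projection P w x t) = trace P"
  using hinner_rotated(1)[of t]
  by (simp add: rotate_projection_def trace_add trace_sub trace_outer hinner_self w)

text \<open>Only the two rank-one terms change the trace, and for a unit or rotated vector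
  \<open>v\<close> the product \<open>outer v ** Q\<close> has trace
  \<open>(norm (Q *v v))\<^sup>2\<close>.\<close>

lemma trace_rotate_projection_mult:
  assumes Q: "orthogonal_projection Q"
  shows "re (trace (rotate_projection P w x t ** Q)) = re (trace (P ** Q))
    - (norm (Q *v w))\<^sup>2 + (norm (cos t *\<^sub>R (Q *v w) + sin t *\<^sub>R (Q *v x)))\<^sup>2"
proof -
  define v where "v = cos t *\<^sub>R w + sin t *\<^sub>R x"
  have "re (trace (rotate_projection P w x t ** Q)) =
      re (trace (P ** Q)) - (norm (Q *v w))\<^sup>2 + (norm (Q *v v))\<^sup>2"
    by (simp add: rotate_projection_def v_def[symmetric] matrix_add_rdistrib matrix_diff_rdistrib
        trace_add trace_sub trace_outer_mult hinner_projection[OF Q] re_add re_diff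
        del: of_real_power)
  then show ?thesis
    by (simp add: v_def matrix_vector_right_distrib matrix_vector_scaleR)
qed

end

text \<open>Finitely many proper subspaces do not cover the space. By induction: if the new matrix
  kills the current \<open>u\<close>, perturb \<open>u\<close> slightly along a vector
  \<open>z\<close> that it does not kill.\<close>

lemma common_nonkernel_vector:
  fixes A :: "'i \<Rightarrow> 'a::real_or_complex^'m^'k"
  assumes "finite J" "\<forall>j\<in>J. A j \<noteq> 0"
  shows "\<exists>u. \<forall>j\<in>J. A j *v u \<noteq> 0"
  using assms
proof (induction J)
  case (insert a J)
  then obtain u where u: "\<forall>j\<in>J. A j *v u \<noteq> 0" by auto
  obtain z where z: "A a *v z \<noteq> 0"
    using insert.prems matrix_vector_mult_eq_0_iff[of "A a"] by auto
  show ?case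
  proof (cases "A a *v u = 0")
    case True
    \<comment> \<open>Every \<open>s > 0\<close> serves the new matrix \<open>A a\<close>, while the
      old ones remain nonzero for small \<open>s\<close> by continuity.\<close>
    have "eventually (\<lambda>s. A j *v u + s *\<^sub>R (A j *v z) \<noteq> 0) (at_right 0)" if "j \<in> J" for j
    proof -
      have "((\<lambda>s. A j *v u + s *\<^sub>R (A j *v z)) \<longlongrightarrow> A j *v u + 0 *\<^sub>R (A j *v z)) (at_right 0)"
        by (intro tendsto_intros)
      then show ?thesis using tendsto_imp_eventually_ne u that by fastforce
    qed
    then have "eventually (\<lambda>s. \<forall>j\<in>J. A j *v u + s *\<^sub>R (A j *v z) \<noteq> 0) (at_right (0::real))"
      using insert.hyps by (simp add: eventually_ball_finite)
    moreover have "eventually (\<lambda>s. s > 0) (at_right (0::real))"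
      by (simp add: eventually_at_right_less)
    ultimately have "eventually (\<lambda>s. s > 0 \<and> (\<forall>j\<in>J. A j *v u + s *\<^sub>R (A j *v z) \<noteq> 0)) (at_right (0::real))"
      by eventually_elim auto
    then obtain s :: real where "s > 0" "\<forall>j\<in>J. A j *v u + s *\<^sub>R (A j *v z) \<noteq> 0"
      using eventually_happens trivial_limit_at_right_real by blast
    then have "\<forall>j\<in>insert a J. A j *v (u + s *\<^sub>R z) \<noteq> 0"
      using True z by (simp add: matrix_vector_right_distrib matrix_vector_scaleR)
    then show ?thesis by blast
  qed (use u in auto)
qed simp

section \<open>Coherence and the packing constant\<close>

lemma finite_coherence_set:
  "finite {re (trace (P j ** P j')) | j j'. j \<in> {1..n::nat} \<and> j' \<in> {1..n} \<and> j \<noteq> j'}"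
proof -
  have "{re (trace (P j ** P j')) | j j'. j \<in> {1..n} \<and> j' \<in> {1..n} \<and> j \<noteq> j'}
    \<subseteq> (\<lambda>(j, j'). re (trace (P j ** P j'))) ` ({1..n} \<times> {1..n})" by auto
  then show ?thesis by (rule finite_subset) simp
qed

lemma coherence_ge:
  assumes "j \<in> {1..n}" "j' \<in> {1..n}" "j \<noteq> j'"
  shows "re (trace (P j ** P j')) \<le> coherence n P"
  unfolding coherence_def by (rule Max_ge[OF finite_coherence_set]) (use assms in blast)

lemma coherence_attained:
  assumes "2 \<le> n"
  obtains j j' where "j \<in> {1..n}" "j' \<in> {1..n}" "j \<noteq> j'" "coherence n P = re (trace (P j ** P j'))"
proof -
  let ?S = "{re (trace (P j ** P j')) | j j'. j \<in> {1..n} \<and> j' \<in> {1..n} \<and> j \<noteq> j'}"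
  \<comment> \<open>Two distinct indices exist, so \<open>Max\<close> ranges over a nonempty
    set.\<close>
  have "1 \<in> {1..n}" "2 \<in> {1..n}" "1 \<noteq> (2::nat)" using assms by auto
  then have "?S \<noteq> {}" by blast
  then have "coherence n P \<in> ?S"
    unfolding coherence_def by (rule Max_in[OF finite_coherence_set])
  then show ?thesis using that by blast
qed

lemma coherence_nonneg:
  assumes "2 \<le> n" "packing {1..n} l P"
  shows "0 \<le> coherence n P"
  using coherence_attained[OF assms(1), of P] assms(2) trace_projection_mult_nonneg
  by (metis packing_def)

lemma packing_constant_le_coherence:
  fixes P :: "nat \<Rightarrow> 'a::real_or_complex^'m^'m"
  assumes "2 \<le> n" "packing {1..n} l P"
  shows "packing_constant n l TYPE('a^'m) \<le> coherence n P"
  unfolding packing_constant_def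
proof (rule cInf_lower)
  \<comment> \<open>The infimum is taken in the reals, so it is a lower bound only once the
    coherences are known to be bounded below.\<close>
  show "bdd_below {coherence n P | P :: nat \<Rightarrow> 'a^'m^'m. packing {1..n} l P}"
    by (rule bdd_belowI[of _ 0]) (use coherence_nonneg[OF assms(1)] in blast)
qed (use assms in blast)

text \<open>A sum \<open>Q\<close> of mutually orthogonal projections is a projection, hence so is
  \<open>mat 1 - Q\<close>. Its trace is the dimension minus \<open>card I * l\<close>, which is at
  most zero, so it vanishes.\<close>

lemma orthogonal_packing_complete:
  fixes P :: "'i \<Rightarrow> 'a::real_or_complex^'m^'m"
  assumes pack: "packing I l P" and card: "CARD('m) \<le> card I * l"
    and orth: "\<And>i j. i \<in> I \<Longrightarrow> j \<in> I \<Longrightarrow> i \<noteq> j \<Longrightarrow> P i ** P j = 0"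
  shows "(\<Sum>j\<in>I. P j) = mat 1"
proof -
  define Q where "Q = (\<Sum>j\<in>I. P j)"
  have fin: "finite I" and proj: "\<And>j. j \<in> I \<Longrightarrow> orthogonal_projection (P j)"
    and tr: "\<And>j. j \<in> I \<Longrightarrow> trace (P j) = of_nat l"
    using pack by (auto simp: packing_def)
  have PQ: "P i *v (Q *v y) = P i *v y" if i: "i \<in> I" for i y
  proof -
    have "P i *v (Q *v y) = (\<Sum>j\<in>I. P i *v (P j *v y))"
      by (simp add: Q_def sum_matrix_vector_mult matrix_vector_mult_sum)
    also have "\<dots> = (\<Sum>j\<in>I. if j = i then P i *v y else 0)"
      using orth[OF i] projection_mult_self[OF proj[OF i]]
      by (intro sum.cong) (auto simp: matrix_vector_mul_assoc)
    also have "\<dots> = P i *v y" using fin i by simp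
    finally show ?thesis .
  qed
  have "Q *v (Q *v y) = Q *v y" for y
    \<comment> \<open>Keeping the inner \<open>Q\<close> folded lets \<open>PQ\<close> simplify each
      summand.\<close>
    using PQ by (subst (1 3) Q_def) (simp add: sum_matrix_vector_mult)
  then have "Q ** Q = Q" by (simp add: matrix_eq matrix_vector_mul_assoc[symmetric])
  moreover have "adjoint_matrix Q = Q"
    using projection_adjoint[OF proj] by (simp add: Q_def adjoint_matrix_sum)
  ultimately have "orthogonal_projection (mat 1 - Q)"
    by (simp add: orthogonal_projection_def adjoint_matrix_diff matrix_diff_rdistrib matrix_diff_ldistrib)
  moreover have "re (trace (mat 1 - Q)) \<le> 0"
  proof -
    have "trace Q = of_nat (card I * l)"
    proof -
      have "trace Q = (\<Sum>j\<in>I. trace (P j))"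
        unfolding Q_def by (induction I rule: infinite_finite_induct) (simp_all add: trace_add trace_0[unfolded mat_0])
      then show ?thesis by (simp add: tr)
    qed
    then have "trace (mat 1 - Q) = of_real (real CARD('m) - real (card I * l))"
      by (simp add: trace_sub trace_I)
    then have "re (trace (mat 1 - Q)) = real CARD('m) - real (card I * l)"
      by (simp only: re_of_real)
    then show ?thesis using card by (simp del: of_nat_mult)
  qed
  ultimately have "mat 1 - Q = 0" by (rule projection_eq_0_if_trace_le_0)
  then show ?thesis by (simp add: Q_def)
qed

text \<open>The vector \<open>x\<close> stays fixed in the descent while the packing varies. The
  rotated subspace need not be orthogonal to \<open>x\<close>, but it no longer achieves the
  constant, so the assumption on \<open>x\<close> carries over to the new packing.\<close>

lemma achieving_packing_detects_vector:
  fixes P :: "nat \<Rightarrow> 'a::real_or_complex^'m^'m"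
  assumes n: "2 \<le> n" and \<mu>: "0 < packing_constant n l TYPE('a^'m)"
    and x: "norm x = 1"
    and opt: "optimally_spread n l P"
  shows "\<exists>k\<in>{1..n}. achieves_packing_constant n l P k \<and> P k *v x \<noteq> 0"
  using opt
proof (induction "card {k\<in>{1..n}. achieves_packing_constant n l P k}" arbitrary: P rule: less_induct)
  case less
  define \<mu> where "\<mu> = packing_constant n l TYPE('a^'m)"
  have "packing {1..n} l P" and coh: "coherence n P = \<mu>"
    using less.prems by (auto simp: optimally_spread_def \<mu>_def)
  then have proj: "\<And>j. j \<in> {1..n} \<Longrightarrow> orthogonal_projection (P j)"
    and tr: "\<And>j. j \<in> {1..n} \<Longrightarrow> trace (P j) = of_nat l"
    by (auto simp: packing_def)
  have ach: "achieves_packing_constant n l R k \<longleftrightarrow> (\<exists>k'\<in>{1..n}. k' \<noteq> k \<and> re (trace (R k ** R k')) = \<mu>)"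
    for R :: "nat \<Rightarrow> 'a^'m^'m" and k
    by (simp add: achieves_packing_constant_def \<mu>_def)
  show ?case
  proof (rule ccontr)
    assume "\<not> ?case"
    then have ker: "P k *v x = 0" if "k \<in> {1..n}" "achieves_packing_constant n l P k" for k
      using that by blast
    \<comment> \<open>The subspace with index \<open>k\<close> will be rotated; \<open>k0\<close>
      ensures that it has a partner at maximal correlation.\<close>
    obtain k k0 where k: "k \<in> {1..n}" "k0 \<in> {1..n}" "k \<noteq> k0" "re (trace (P k ** P k0)) = \<mu>"
      using coherence_attained[OF n, of P] coh by metis
    then have kach: "achieves_packing_constant n l P k" by (auto simp: ach)
    define J where "J = {j\<in>{1..n}. j \<noteq> k \<and> re (trace (P k ** P j)) = \<mu>}"
    \<comment> \<open>Correlation is symmetric, so the members of \<open>J\<close> achieve the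
      constant as well and therefore kill \<open>x\<close>.\<close>
    have Jach: "achieves_packing_constant n l P j" if "j \<in> J" for j
      using that k(1) trace_mul_sym[of "P k" "P j"] by (auto simp: J_def ach)
    \<comment> \<open>Here positivity of the packing constant enters: a vanishing product would
      force correlation zero.\<close>
    have "P j ** P k \<noteq> 0" if "j \<in> J" for j
      using that \<mu> trace_projection_mult_le_0[OF proj[OF k(1)], of "P j"] proj
      by (auto simp: J_def \<mu>_def)
    then obtain u where u: "\<forall>j\<in>J. (P j ** P k) *v u \<noteq> 0"
      using common_nonkernel_vector[of J "\<lambda>j. P j ** P k"] by (auto simp: J_def)
    define w where "w = (1 / norm (P k *v u)) *\<^sub>R (P k *v u)"
    have "k0 \<in> J" using k by (auto simp: J_def)
    \<comment> \<open>As \<open>J\<close> contains \<open>k0\<close>, some product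
      \<open>P j ** P k\<close> does not kill \<open>u\<close>, so the vector to be normalised is
      nonzero.\<close>
    then have Pu: "P k *v u \<noteq> 0"
      using u by (force simp: matrix_vector_mul_assoc[symmetric])
    have w: "P k *v w = w" "norm w = 1"
      using Pu projection_idem[OF proj[OF k(1)]] by (simp_all add: w_def matrix_vector_scaleR)
    have Pjw: "P j *v w \<noteq> 0" if "j \<in> J" for j
      using u that Pu by (simp add: w_def matrix_vector_scaleR matrix_vector_mul_assoc)
    note rot = proj[OF k(1)] w ker[OF k(1) kach] x
    define R where "R = rotate_projection (P k) w x"
    have ev: "eventually (\<lambda>t. re (trace (R t ** P j)) < \<mu>) (at_right 0)"
      if j: "j \<in> {1..n} - {k}" for j
    proof (cases "j \<in> J")
      case True
      have "eventually (\<lambda>t. t \<in> {0<..<pi}) (at_right (0::real))"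
        by (intro eventually_at_right_real pi_gt_zero)
      then show ?thesis
      proof eventually_elim
        case (elim t)
        have "sin t > 0" using elim by (intro sin_gt_zero) auto
        then have "0 < (sin t)\<^sup>2 * (norm (P j *v w))\<^sup>2" using Pjw[OF True] by simp
        \<comment> \<open>Because \<open>P j\<close> kills \<open>x\<close>, the sine term
          disappears and the correlation drops by
          \<open>(sin t)\<^sup>2 * (norm (P j *v w))\<^sup>2\<close>.\<close>
        moreover have "re (trace (R t ** P j)) = \<mu> - (norm (P j *v w))\<^sup>2 + (cos t)\<^sup>2 * (norm (P j *v w))\<^sup>2"
          using True proj ker[OF _ Jach[OF True]]
          by (simp add: R_def trace_rotate_projection_mult[OF rot] J_def power_mult_distrib)
        ultimately show ?case by (simp add: cos_squared_eq algebra_simps)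
      qed
    next
      case False
      \<comment> \<open>The limit at \<open>t = 0\<close> is the old correlation, which is strictly
        below \<open>\<mu>\<close> because \<open>j\<close> lies outside \<open>J\<close>.\<close>
      have "((\<lambda>t. re (trace (R t ** P j))) \<longlongrightarrow> re (trace (P k ** P j)) - (norm (P j *v w))\<^sup>2
          + (norm (cos 0 *\<^sub>R (P j *v w) + sin 0 *\<^sub>R (P j *v x)))\<^sup>2) (at_right 0)"
        unfolding R_def trace_rotate_projection_mult[OF rot proj[OF DiffD1[OF j]]]
        by (intro tendsto_intros)
      moreover have "re (trace (P k ** P j)) < \<mu>"
        using coherence_ge[of k n j P] j k(1) False coh by (force simp: J_def)
      ultimately show ?thesis by (intro order_tendstoD) auto
    qed
    \<comment> \<open>Finitely many conditions hold simultaneously for a suitable small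
      \<open>t\<close>.\<close>
    have "eventually (\<lambda>t. \<forall>j\<in>{1..n} - {k}. re (trace (R t ** P j)) < \<mu>) (at_right 0)"
      by (intro eventually_ball_finite ballI ev) simp
    then have "\<exists>t. \<forall>j\<in>{1..n} - {k}. re (trace (R t ** P j)) < \<mu>"
      by (rule eventually_happens'[rotated]) simp
    then obtain t where t: "\<And>j. j \<in> {1..n} \<Longrightarrow> j \<noteq> k \<Longrightarrow> re (trace (R t ** P j)) < \<mu>" by blast
    define P' where "P' = P(k := R t)"
    have P'k: "re (trace (P' i ** P' j)) < \<mu>" if "i \<in> {1..n}" "j \<in> {1..n}" "i \<noteq> j" "i = k \<or> j = k" for i j
      using that t[of i] t[of j] trace_mul_sym[of "P i" "R t"] by (auto simp: P'_def)
    have "packing {1..n} l P'"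
      using proj tr k(1) orthogonal_projection_rotate[OF rot] trace_rotate_projection[OF rot]
      by (auto simp: packing_def P'_def R_def)
    \<comment> \<open>Pairs involving \<open>k\<close> are now strictly below \<open>\<mu>\<close>;
      all other correlations are unchanged.\<close>
    moreover have "coherence n P' \<le> \<mu>"
    proof -
      obtain i j where ij: "i \<in> {1..n}" "j \<in> {1..n}" "i \<noteq> j" "coherence n P' = re (trace (P' i ** P' j))"
        using coherence_attained[OF n, of P'] by metis
      show ?thesis
      proof (cases "i = k \<or> j = k")
        case True
        then show ?thesis using P'k[OF ij(1-3)] ij(4) by simp
      next
        case False
        then show ?thesis using coherence_ge[OF ij(1-3), of P] coh ij(4) by (simp add: P'_def)
      qed
    qed
    ultimately have opt': "optimally_spread n l P'"
      using packing_constant_le_coherence[OF n, of l P'] by (simp add: optimally_spread_def \<mu>_def)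
    \<comment> \<open>A pair at correlation \<open>\<mu>\<close> in \<open>P'\<close> cannot involve
      \<open>k\<close>, so it consists of old projections and achieves the constant in
      \<open>P\<close> too.\<close>
    have sub: "j \<noteq> k \<and> achieves_packing_constant n l P j"
      if "j \<in> {1..n}" and a: "achieves_packing_constant n l P' j" for j
    proof -
      obtain i where i: "i \<in> {1..n}" "i \<noteq> j" "re (trace (P' j ** P' i)) = \<mu>"
        using a by (auto simp: ach)
      then have "j \<noteq> k" "i \<noteq> k" using P'k[of j i] that(1) by auto
      with i show ?thesis by (auto simp: ach P'_def)
    qed
    have "card {k\<in>{1..n}. achieves_packing_constant n l P' k}
        < card {k\<in>{1..n}. achieves_packing_constant n l P k}"
      by (rule psubset_card_mono) (use sub k(1) kach in auto)
    from less.hyps[OF this opt'] obtain j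
      where "j \<in> {1..n}" "achieves_packing_constant n l P' j" "P' j *v x \<noteq> 0" by blast
    \<comment> \<open>The index found differs from \<open>k\<close>, so \<open>P' j\<close> is the
      old \<open>P j\<close>, which kills \<open>x\<close>.\<close>
    with sub[of j] ker[of j] show False by (auto simp: P'_def)
  qed
qed

text \<open>Either the constant is positive and the descent applies to the normalised
  \<open>x\<close>, or it is zero; then every index achieves it, and the orthogonal subspaces fill
  the space because \<open>n * l\<close> is at least the dimension.\<close>

lemma achieving_subspaces_complete:
  fixes P :: "nat \<Rightarrow> 'a::real_or_complex^'m^'m"
  assumes l: "1 \<le> l" and m: "CARD('m) \<le> n" and n: "2 \<le> n"
    and opt: "optimally_spread n l P" and x: "x \<noteq> 0"
  shows "\<exists>k\<in>{1..n}. achieves_packing_constant n l P k \<and> P k *v x \<noteq> 0"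
proof (cases "packing_constant n l TYPE('a^'m) > 0")
  case True
  have "norm ((1 / norm x) *\<^sub>R x) = 1" using x by simp
  from achieving_packing_detects_vector[OF n True this opt] show ?thesis
    by (auto simp: matrix_vector_scaleR)
next
  case False
  have pack: "packing {1..n} l P" and coh: "coherence n P = packing_constant n l TYPE('a^'m)"
    using opt by (auto simp: optimally_spread_def)
  then have \<mu>: "coherence n P = 0" using False coherence_nonneg[OF n pack] by simp
  have proj: "\<And>j. j \<in> {1..n} \<Longrightarrow> orthogonal_projection (P j)"
    using pack by (auto simp: packing_def)
  \<comment> \<open>Nonnegative correlations with maximum zero all vanish, and a vanishing
    correlation means a vanishing product.\<close>
  have tr: "re (trace (P i ** P j)) = 0" and orth: "P i ** P j = 0"
    if "i \<in> {1..n}" "j \<in> {1..n}" "i \<noteq> j" for i j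
    using coherence_ge[OF that, of P] coherence_ge[of j n i P] that \<mu>
      trace_projection_mult_nonneg[OF proj proj] trace_projection_mult_le_0[OF proj proj, of j i]
    by force+
  have "CARD('m) \<le> n * l" using m l by (metis le_trans mult_le_mono2 mult.right_neutral)
  then have "(\<Sum>j\<in>{1..n}. P j) = mat 1"
    by (intro orthogonal_packing_complete[OF pack]) (auto intro: orth)
  then have "(\<Sum>j\<in>{1..n}. P j *v x) \<noteq> 0"
    using x by (simp flip: sum_matrix_vector_mult)
  then obtain k where k: "k \<in> {1..n}" "P k *v x \<noteq> 0"
    by (meson sum.neutral)
  \<comment> \<open>Any second index is a witness, since every correlation equals the constant
    zero.\<close>
  obtain j where "j \<in> {1..n}" "j \<noteq> k"
    using n by (metis atLeastAtMost_iff le_trans one_le_numeral order_refl numeral_eq_one_iff semiring_norm(85))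
  then have "achieves_packing_constant n l P k"
    using tr[OF k(1)] \<mu> coh by (auto simp: achieves_packing_constant_def)
  with k show ?thesis by blast
qed

section \<open>From detecting vectors to fusion frames and spans\<close>

lemma positive_definite_sum_projections:
  fixes P :: "'i \<Rightarrow> 'a::real_or_complex^'m^'m"
  assumes pack: "packing I l P" and det: "\<And>x. x \<noteq> 0 \<Longrightarrow> \<exists>k\<in>I. P k *v x \<noteq> 0"
  shows "positive_definite (\<Sum>j\<in>I. P j)"
proof -
  have fin: "finite I" and proj: "\<And>j. j \<in> I \<Longrightarrow> orthogonal_projection (P j)"
    using pack by (auto simp: packing_def)
  have "re (hinner x ((\<Sum>j\<in>I. P j) *v x)) > 0" if x: "x \<noteq> 0" for x
  proof -
    \<comment> \<open>The quadratic form of the sum is the sum of the squared norms of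
      \<open>P j *v x\<close>, positive as soon as one term is nonzero.\<close>
    have "hinner x ((\<Sum>j\<in>I. P j) *v x) = (\<Sum>j\<in>I. hinner x (P j *v x))"
      unfolding sum_matrix_vector_mult
      by (induction I rule: infinite_finite_induct) (simp_all add: hinner_add_right)
    also have "\<dots> = of_real (\<Sum>j\<in>I. (norm (P j *v x))\<^sup>2)"
      by (simp add: hinner_projection[OF proj])
    finally have "re (hinner x ((\<Sum>j\<in>I. P j) *v x)) = (\<Sum>j\<in>I. (norm (P j *v x))\<^sup>2)"
      by (simp only: re_of_real)
    moreover obtain k where "k \<in> I" "P k *v x \<noteq> 0" using det[OF x] by blast
    ultimately show ?thesis using fin by (auto intro!: sum_pos2[of I k])
  qed
  moreover have "adjoint_matrix (\<Sum>j\<in>I. P j) = (\<Sum>j\<in>I. P j)"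
    using projection_adjoint[OF proj] by (simp add: adjoint_matrix_sum)
  ultimately show ?thesis by (simp add: positive_definite_def hinner_def)
qed

text \<open>A positive definite matrix is injective, hence surjective in finite dimension, and each
  value of the sum is a sum of vectors from the subspaces.\<close>

lemma positive_definite_imp_span:
  fixes P :: "'i \<Rightarrow> 'a::real_or_complex^'m^'m"
  assumes "positive_definite (\<Sum>j\<in>I. P j)"
  shows "vec.span (\<Union>k\<in>I. range ((*v) (P k))) = UNIV"
proof -
  let ?S = "\<Sum>j\<in>I. P j"
  have "x = 0" if "?S *v x = 0" for x
  proof (rule ccontr)
    assume "x \<noteq> 0"
    then have "0 < re (\<Sum>i\<in>UNIV. cconj (x $ i) * (?S *v x) $ i)"
      using assms unfolding positive_definite_def by blast
    then show False by (simp add: that)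
  qed
  then have "inj ((*v) ?S)"
    by (simp add: vec.inj_iff_eq_0 matrix_vector_mul_linear_gen)
  then have surj: "surj ((*v) ?S)"
    by (simp add: vec.linear_inj_imp_surj matrix_vector_mul_linear_gen)
  have "y \<in> vec.span (\<Union>k\<in>I. range ((*v) (P k)))" for y
  proof -
    obtain z where y: "y = ?S *v z" using surj by (rule surjE)
    show ?thesis
      unfolding y sum_matrix_vector_mult by (rule vec.span_sum, rule vec.span_base) blast
  qed
  then show ?thesis by blast
qed

theorem theorem3p3:
  fixes P :: "nat \<Rightarrow> 'a::real_or_complex^'m^'m"
    and n l :: nat
    and K :: "nat set"
  assumes "1 \<le> l" and "l \<le> CARD('m)" and "CARD('m) \<le> n" and "2 \<le> n"
    and "optimally_spread n l P"
    and "K = {k \<in> {1..n}. achieves_packing_constant n l P k}"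
  shows "vec.span (\<Union>k\<in>K. range ((*v) (P k))) = UNIV
    \<and> fusion_frame K (card K) l P
    \<and> fusion_frame {1..n} n l P
    \<and> grassmannian_fusion_frame n l P"
proof -
  \<comment> \<open>Detection by \<open>K\<close> gives positive definiteness over \<open>K\<close>
    and, since \<open>K\<close> is contained in \<open>{1..n}\<close>, over the full index
    set.\<close>
  have det: "\<exists>k\<in>K. P k *v x \<noteq> 0" if "x \<noteq> 0" for x
    using achieving_subspaces_complete[OF assms(1,3,4,5) that] by (auto simp: assms(6))
  have pack: "packing {1..n} l P" using assms(5) by (simp add: optimally_spread_def)
  then have packK: "packing K l P" by (auto simp: packing_def assms(6))
  have pdK: "positive_definite (\<Sum>j\<in>K. P j)"
    by (rule positive_definite_sum_projections[OF packK det])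
  have "positive_definite (\<Sum>j\<in>{1..n}. P j)"
  proof (rule positive_definite_sum_projections[OF pack])
    show "\<exists>k\<in>{1..n}. P k *v x \<noteq> 0" if "x \<noteq> 0" for x
      using det[OF that] by (auto simp: assms(6))
  qed
  then show ?thesis
    using positive_definite_imp_span[OF pdK] pdK pack packK assms(5)
    by (simp add: fusion_frame_def grassmannian_fusion_frame_def)
qed

end
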